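(* Let $Y$ be the process on the Polish space $E$ killed at rate $\kappa$, with killing time $\tau_\partial$, killed laws $\mathbb{P}_x$ and resolvent $\mathcal{R}$ as defined in the context, and assume $\mathbb{P}_x(\tau_\partial<\infty)=1$ for every $x\in E$. Let $\mu$ be any probability measure on $E$ and let $\mathbb{P}_\mu=\int_E\mu(dx)\,\mathbb{P}_x$. Then for every measurable $A\subset E$, $$\mathbb{P}_\mu\left(Y_{\tau_\partial}\in A\right)=\mu\mathcal{R}(\kappa 1_A),$$ where $\mu\mathcal{R}(\kappa 1_A)=\int_E \mu(dx)\,\mathcal{R}(\kappa 1_A)(x)$.
   Context: Setting. $E$ is a Polish space. $\tilde Y=(\tilde\Omega,\tilde{\mathcal F},\tilde{\mathcal F}_t,\tilde Y_t,\tilde\theta_t,\tilde{\mathbb P}_x)$ is a continuous-time càdlàg right process on $E$ in the sense of Sharpe's "General Theory of Markov Processes" (in particular a strong Markov process with right-continuous paths and $\tilde{\mathbb P}_x(\tilde Y_0=x)=1$), with infinite lifetime (unkilled), realised canonically: $\tilde\Omega$ is the space of càdlàg paths $[0,\infty)\to E$ with the cylinder $\sigma$-algebra and the usual shifts. $\kappa:E\to[0,\infty)$ is a locally bounded measurable function (the killing rate). Augmented space. Let $\mathcal X=\{0,\partial\}\times E$. Let $\Omega$ be the space of càdlàg paths $\omega:[0,\infty)\to\mathcal X$ for which $\{\partial\}\times E$ is a trap: with coordinate process $Z_t(\omega)=\omega(t)=(e_t,Y_t)$, $e_t\in\{0,\partial\}$, $Y_t\in E$, and $$\tau_\partial(\omega)=\inf\{t\ge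 0: Z_t(\omega)\in\{\partial\}\times E\},$$ one has $\omega(s)=\omega(\tau_\partial)$ for all $s\ge\tau_\partial(\omega)$. $\Omega$ carries the cylinder $\sigma$-algebra. Thus $Y_{\tau_\partial}$ is the location at which the process is killed. Killing operators. For $t\ge0$ define $k_t:\Omega\to\Omega$ as follows, for $\omega=(e,\tilde\omega)$. If $t<\tau_\partial(\omega)$, then $k_t(\omega)(s)=\omega(s)$ for $0\le s<t$ and $k_t(\omega)(s)=(\partial,\tilde\omega(t))$ for $s\ge t$. If $t\ge\tau_\partial(\omega)$, then $k_t(\omega)=\omega$. Laws. $\mathbb P^0_x$ is the image of $\tilde{\mathbb P}_x$ under the map $\psi:\tilde\Omega\to\Omega$, $\psi(\tilde\omega)(s)=(0,\tilde\omega(s))$. Let $m_t=\exp\left(-\int_0^t\kappa(Y_s)\,ds\right)$, so that $-dm_t=\kappa(Y_t)m_t\,dt$. The killed law $\mathbb P_x$ on $\Omega$ is defined, for bounded measurable $H$ on $\Omega$, by $$\mathbb P_x(H)=\mathbb P^0_x\left[\int_0^\infty H\circ k_t\,(-dm_t)\right].$$ Here points $x\in E$ are identified with $(0,x)\in\{0\}\times E$, and a law applied to a function denotes expectation. Standing assumption: killing occurs in finite time almost surely from every starting point, $\mathbb P_x(\tau_\partial<\infty)=1$ for all $x\in E$; equivalently $\int_0^\infty\kappa(Y_s)\,ds=\infty$ holds $\mathbb P^0_x$-almost surely, so that there is no mass at $t=\infty$ in the formula $\mathbb P_x(H)=\mathbb P^0_x\left[\int_0^\infty H\circ k_t\,(-dm_t)\right]$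 defining $\mathbb P_x$. Semigroup and resolvent. For nonnegative measurable $f$ on $E$, $P_t(x,f)=\mathbb P_x\left[f(Y_t)1_{\{\tau_\partial>t\}}\right]$ is the sub-Markovian semigroup of the killed process, and $$\mathcal R f(x)=\int_0^\infty P_t(x,f)\,dt .$$ *)

theory Defs
  imports "HOL-Probability.Probability"
begin

section \<open>Spaces of paths on the half-line\<close>

text \<open>
  A path \<open>[0,\<infinity>) \<rightarrow> E\<close> is a function on \<open>real\<close> that is extensional on \<open>{0..}\<close>, so that the
  product \<open>\<sigma>\<close>-algebra over the index set \<open>{0..}\<close> is the cylinder \<open>\<sigma>\<close>-algebra.
\<close>

definition cadlag :: "(real \<Rightarrow> 'b::topological_space) \<Rightarrow> bool" where
  "cadlag w \<longleftrightarrow> (\<forall>t\<ge>0. (w \<longlongrightarrow> w t) (at_right t)) \<and> (\<forall>t>0. \<exists>l. (w \<longlongrightarrow> l) (at_left t))"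

definition path_space :: "(real \<Rightarrow> 'b::topological_space) measure" where
  "path_space = restrict_space (Pi\<^sub>M {0..} (\<lambda>_. borel)) {w. cadlag w}"

definition shift :: "real \<Rightarrow> (real \<Rightarrow> 'b) \<Rightarrow> real \<Rightarrow> 'b" where
  "shift s w = (\<lambda>t\<in>{0..}. w (s + t))"


section \<open>Right processes, realised on the space of cadlag paths\<close>

text \<open>
  As in Sharpe's book, functions of the starting point are only required to be universally
  measurable. Integrals against an initial law therefore use its completion.
\<close>

definition initial_law :: "'a::topological_space measure \<Rightarrow> bool" where
  "initial_law \<mu> \<longleftrightarrow> prob_space \<mu> \<and> sets \<mu> = sets borel"

definition universally_measurable :: "('a::topological_space \<Rightarrow> ennreal) \<Rightarrow> bool" where
  "universally_measurable f \<longleftrightarrow> (\<forall>\<mu>. initial_law \<mu> \<longrightarrow> f \<in> borel_measurable (completion \<mu>))"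

definition mixed_law :: "'a measure \<Rightarrow> ('a \<Rightarrow> 'w measure) \<Rightarrow> 'w measure" where
  "mixed_law \<mu> P = completion \<mu> \<bind> P"

definition natural_filtration :: "real \<Rightarrow> (real \<Rightarrow> 'a::topological_space) set set" where
  "natural_filtration t = sigma_sets (space path_space)
     {{w \<in> space path_space. w s \<in> B} | s B. 0 \<le> s \<and> s \<le> t \<and> B \<in> sets borel}"

text \<open>
  The usual augmentation of the natural filtration: the intersection over all initial laws
  \<open>\<mu>\<close> of the \<open>\<sigma>\<close>-algebra generated by the natural filtration at time \<open>t\<close> and the null sets of
  the law started from \<open>\<mu>\<close>.
\<close>

definition augmented_filtration ::
    "('a::topological_space \<Rightarrow> (real \<Rightarrow> 'a) measure) \<Rightarrow> real \<Rightarrow> (real \<Rightarrow> 'a) set set" where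
  "augmented_filtration P t = {L. L \<subseteq> space path_space \<and>
     (\<forall>\<mu>. initial_law \<mu> \<longrightarrow>
       (\<exists>L' \<in> natural_filtration t. \<exists>N \<in> null_sets (mixed_law \<mu> P). sym_diff L L' \<subseteq> N))}"

definition transition :: "('a \<Rightarrow> (real \<Rightarrow> 'a) measure) \<Rightarrow> real \<Rightarrow> 'a \<Rightarrow> ('a \<Rightarrow> ennreal) \<Rightarrow> ennreal" where
  "transition P t x f = (\<integral>\<^sup>+w. f (w t) \<partial>completion (P x))"

definition excessive ::
    "('a::topological_space \<Rightarrow> (real \<Rightarrow> 'a) measure) \<Rightarrow> real \<Rightarrow> ('a \<Rightarrow> ennreal) \<Rightarrow> bool" where
  "excessive P \<alpha> f \<longleftrightarrow> universally_measurable f \<and>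
     (\<forall>x. \<forall>t\<ge>0. ennreal (exp (- \<alpha> * t)) * transition P t x f \<le> f x) \<and>
     (\<forall>x. ((\<lambda>t. ennreal (exp (- \<alpha> * t)) * transition P t x f) \<longlongrightarrow> f x) (at_right 0))"

text \<open>
  An unkilled right process in its canonical realisation. The assumption \<open>hd2\<close> is Sharpe's
  second droite hypothesis; the strong Markov property follows from it.
\<close>

locale right_process =
  fixes P :: "'a::polish_space \<Rightarrow> (real \<Rightarrow> 'a) measure"
  assumes prob: "prob_space (P x)"
    and sets_law: "sets (P x) = sets path_space"
    and kernel: "L \<in> sets path_space \<Longrightarrow> universally_measurable (\<lambda>x. emeasure (P x) L)"
    and normal: "emeasure (P x) {w \<in> space path_space. w 0 = x} = 1"
    and markov: "\<lbrakk>initial_law \<mu>; 0 \<le> s; L \<in> augmented_filtration P s; G \<in> sets path_space\<rbrakk> \<Longrightarrow>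
      emeasure (completion (mixed_law \<mu> P)) {w \<in> L. shift s w \<in> G} =
        (\<integral>\<^sup>+w\<in>L. emeasure (P (w s)) G \<partial>completion (mixed_law \<mu> P))"
    and hd2: "\<lbrakk>0 < \<alpha>; excessive P \<alpha> f; initial_law \<mu>\<rbrakk> \<Longrightarrow>
      AE w in mixed_law \<mu> P. \<forall>t\<ge>0. ((\<lambda>s. f (w s)) \<longlongrightarrow> f (w t)) (at_right t)"


section \<open>Killing at a state-dependent rate\<close>

definition locally_bounded :: "('a::topological_space \<Rightarrow> real) \<Rightarrow> bool" where
  "locally_bounded \<kappa> \<longleftrightarrow> (\<forall>x. \<exists>U. open U \<and> x \<in> U \<and> bounded (\<kappa> ` U))"

text \<open>
  The augmented space \<open>{0,\<partial>} \<times> E\<close> is \<open>bool \<times> 'a\<close>, with \<open>False\<close> for \<open>0\<close> and \<open>True\<close> for \<open>\<partial>\<close>;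
  the topology of \<open>bool\<close> is discrete.
\<close>

definition killing_time :: "(real \<Rightarrow> bool \<times> 'a) \<Rightarrow> ereal" where
  "killing_time w = Inf (ereal ` {t. 0 \<le> t \<and> w t \<in> {True} \<times> UNIV})"

definition killed_path_space :: "(real \<Rightarrow> bool \<times> 'a::topological_space) measure" where
  "killed_path_space = restrict_space (Pi\<^sub>M {0..} (\<lambda>_. borel))
     {w. cadlag w \<and>
         (\<forall>s\<ge>0. killing_time w \<le> ereal s \<longrightarrow> w s = w (real_of_ereal (killing_time w)))}"

text \<open>Meaningful only for paths whose killing time is finite.\<close>

definition killing_location :: "(real \<Rightarrow> bool \<times> 'a) \<Rightarrow> 'a" where
  "killing_location w = snd (w (real_of_ereal (killing_time w)))"

definition kill :: "real \<Rightarrow> (real \<Rightarrow> bool \<times> 'a) \<Rightarrow> real \<Rightarrow> bool \<times> 'a" where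
  "kill t w =
     (if ereal t < killing_time w then \<lambda>s\<in>{0..}. if s < t then w s else (True, snd (w t)) else w)"

definition alive_path :: "(real \<Rightarrow> 'a) \<Rightarrow> real \<Rightarrow> bool \<times> 'a" where
  "alive_path w = (\<lambda>s\<in>{0..}. (False, w s))"

definition unkilled_law ::
    "('a::topological_space \<Rightarrow> (real \<Rightarrow> 'a) measure) \<Rightarrow> 'a \<Rightarrow> (real \<Rightarrow> bool \<times> 'a) measure" where
  "unkilled_law P x = distr (P x) killed_path_space alive_path"

text \<open>For \<open>t < 0\<close> the integral is over the empty interval, so that the value is \<open>1\<close>.\<close>

definition survival :: "('a \<Rightarrow> real) \<Rightarrow> (real \<Rightarrow> bool \<times> 'a) \<Rightarrow> real \<Rightarrow> real" where
  "survival \<kappa> w t = exp (- (LBINT s:{0..t}. \<kappa> (snd (w s))))"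

text \<open>
  The killed law, given by its values on events. The measure \<open>- dm\<^sub>t\<close> is the Lebesgue-Stieltjes
  measure of the nondecreasing continuous function \<open>- m\<close>.
\<close>

definition killed_law ::
    "('a::topological_space \<Rightarrow> (real \<Rightarrow> 'a) measure) \<Rightarrow> ('a \<Rightarrow> real) \<Rightarrow> 'a \<Rightarrow>
      (real \<Rightarrow> bool \<times> 'a) measure" where
  "killed_law P \<kappa> x = measure_of (space killed_path_space) (sets killed_path_space)
     (\<lambda>L. \<integral>\<^sup>+w. (\<integral>\<^sup>+t\<in>{0..}. indicator L (kill t w) \<partial>interval_measure (\<lambda>t. - survival \<kappa> w t))
             \<partial>unkilled_law P x)"

definition killed_semigroup ::
    "('a::topological_space \<Rightarrow> (real \<Rightarrow> 'a) measure) \<Rightarrow> ('a \<Rightarrow> real) \<Rightarrow>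
      real \<Rightarrow> 'a \<Rightarrow> ('a \<Rightarrow> ennreal) \<Rightarrow> ennreal" where
  "killed_semigroup P \<kappa> t x f =
     (\<integral>\<^sup>+w. f (snd (w t)) * indicator {w. ereal t < killing_time w} w \<partial>killed_law P \<kappa> x)"

definition resolvent ::
    "('a::topological_space \<Rightarrow> (real \<Rightarrow> 'a) measure) \<Rightarrow> ('a \<Rightarrow> real) \<Rightarrow>
      ('a \<Rightarrow> ennreal) \<Rightarrow> 'a \<Rightarrow> ennreal" where
  "resolvent P \<kappa> f x = (\<integral>\<^sup>+t\<in>{0..}. killed_semigroup P \<kappa> t x f \<partial>lborel)"

end

theory Submission
  imports Defs
begin

text \<open>
  Fix an unkilled path \<open>w\<close> and write \<open>k t = \<kappa> (w t)\<close>, \<open>m t = exp (- \<integral>\<^sub>0\<^sup>t k)\<close>. The killed law chooses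
  the killing time of \<open>w\<close> with the Lebesgue-Stieltjes measure \<open>- dm\<close>, and \<open>- dm\<close> has the density
  \<open>k t * m t\<close>. Hence
  \<open>P\<^sub>x (killed in A) = E\<^sub>x [\<integral> k t * m t * 1\<^sub>A (w t) dt]\<close>.
  On the other hand, the killed semigroup integrates \<open>f (w t)\<close> against the mass that \<open>- dm\<close> gives
  to \<open>(t, \<infinity>)\<close>. This mass is \<open>m t\<close>, since \<open>- dm\<close> has total mass one almost surely: its total mass is
  at most one and its expectation is the probability of being killed in finite time. Integrating
  \<open>\<kappa> 1\<^sub>A\<close> over time therefore gives \<open>\<integral> E\<^sub>x [\<kappa> (w t) 1\<^sub>A (w t) m t] dt\<close>, and exchanging the two
  integrals proves the identity for every starting point (\<open>killing_location_law\<close>).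

  The work lies in making these formulas literally true. The rate \<open>k\<close> is measurable and locally
  bounded but not continuous, so \<open>m\<close> need not be differentiable and the density of \<open>- dm\<close> requires
  an argument (\<open>interval_measure_survivor\<close>). Joint measurability in path and time comes
  from right-continuity (\<open>evaluation_measurable\<close>). It allows the killed law to be written as an
  image measure (\<open>killed_law_eq\<close>), so that the prescription for its values on events is indeed a
  measure, and integrals against it can be computed with Fubini's theorem. Finally, it makes the
  killed law a universally measurable kernel (\<open>killed_law_kernel\<close>), and the identity can be
  integrated against the initial law.
\<close>

section \<open>Lifetimes with a locally bounded hazard rate\<close>

definition cumulative_hazard :: "(real \<Rightarrow> real) \<Rightarrow> real \<Rightarrow> real" where
  "cumulative_hazard k t = (LBINT s:{0..t}. k s)"

definition survivor_function :: "(real \<Rightarrow> real) \<Rightarrow> real \<Rightarrow> real" where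
  "survivor_function k t = exp (- cumulative_hazard k t)"

definition lifetime_density :: "(real \<Rightarrow> real) \<Rightarrow> real \<Rightarrow> ennreal" where
  "lifetime_density k t = indicator {0..} t * ennreal (k t * survivor_function k t)"

locale hazard_rate =
  fixes k :: "real \<Rightarrow> real"
  assumes rate_borel [measurable]: "k \<in> borel_measurable borel"
    and rate_nonneg: "0 \<le> k t"
    and rate_bounded: "\<exists>C. \<forall>t\<in>{0..T}. k t \<le> C"
begin

abbreviation "cumulative \<equiv> cumulative_hazard k"
abbreviation "survivor \<equiv> survivor_function k"
abbreviation "killing_density \<equiv> lifetime_density k"

lemma rate_boundE:
  obtains C where "\<And>t. t \<in> {0..T} \<Longrightarrow> k t \<le> C"
  using rate_bounded[of T] by blast

lemma set_integrable_rate: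
  assumes "0 \<le> a" shows "set_integrable lborel {a..b} k"
proof -
  obtain C where "\<forall>t\<in>{0..b}. k t \<le> C" using rate_bounded by blast
  then have "norm (k t) \<le> C" if "t \<in> {a..b}" for t using that assms rate_nonneg[of t] by auto
  then show ?thesis unfolding set_integrable_def
    by (intro integrableI_bounded_set_indicator[where B=C]) (auto simp: emeasure_lborel_Icc_eq)
qed

lemma set_integrable_rate_Ioc:
  assumes "0 \<le> a" shows "set_integrable lborel {a<..b} k"
  by (rule set_integrable_subset[OF set_integrable_rate[OF assms, of b]]) auto

lemma cumulative_diff:
  assumes "0 \<le> a" "a \<le> b"
  shows "cumulative b - cumulative a = (LBINT s:{a<..b}. k s)"
proof -
  have "cumulative b = (LBINT s:{0..a} \<union> {a<..b}. k s)"
    unfolding cumulative_hazard_def using assms by (simp add: ivl_disj_un)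
  also have "\<dots> = cumulative a + (LBINT s:{a<..b}. k s)"
    unfolding cumulative_hazard_def
    by (rule set_integral_Un) (use assms in \<open>auto intro: set_integrable_rate set_integrable_rate_Ioc\<close>)
  finally show ?thesis by simp
qed

lemma cumulative_nonpos: "t \<le> 0 \<Longrightarrow> cumulative t = 0"
proof -
  assume t: "t \<le> 0"
  have "AE s in lborel. s \<notin> {0..t}"
    using AE_lborel_singleton[of 0] t by (auto elim: AE_mp)
  then have "AE s in lborel. indicator {0..t} s *\<^sub>R k s = 0"
    by (auto simp: indicator_def elim: AE_mp)
  then show ?thesis unfolding cumulative_hazard_def set_lebesgue_integral_def
    by (rule integral_eq_zero_AE)
qed

lemma cumulative_increment:
  assumes "0 \<le> a" "a \<le> b" and C: "\<And>t. t \<in> {0..b} \<Longrightarrow> k t \<le> C"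
  shows "0 \<le> cumulative b - cumulative a" "cumulative b - cumulative a \<le> C * (b - a)"
proof -
  show "0 \<le> cumulative b - cumulative a"
    unfolding cumulative_diff[OF assms(1,2)] set_lebesgue_integral_def
    by (intro integral_nonneg_AE) (auto simp: rate_nonneg)
  have "(LBINT s:{a<..b}. k s) \<le> (LBINT s:{a<..b}. C)"
    by (rule set_integral_mono) (use assms set_integrable_rate_Ioc in \<open>auto simp: set_integrable_def\<close>)
  also have "\<dots> = C * (b - a)" using assms by (simp add: set_lebesgue_integral_def)
  finally show "cumulative b - cumulative a \<le> C * (b - a)"
    unfolding cumulative_diff[OF assms(1,2)] .
qed

lemma cumulative_mono: "s \<le> t \<Longrightarrow> cumulative s \<le> cumulative t"
proof -
  assume st: "s \<le> t"
  obtain C where C: "\<And>u. u \<in> {0..t} \<Longrightarrow> k u \<le> C" using rate_boundE by metis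
  show ?thesis
  proof (cases "0 \<le> s")
    case True then show ?thesis using cumulative_increment(1)[OF True st C] by simp
  next
    case False
    show ?thesis
    proof (cases "0 \<le> t")
      case True
      then show ?thesis using cumulative_increment(1)[OF order_refl True C] False
        by (simp add: cumulative_nonpos)
    next
      case False
      then show ?thesis using st by (simp add: cumulative_nonpos)
    qed
  qed
qed

lemma survivor_antimono: "s \<le> t \<Longrightarrow> survivor t \<le> survivor s"
  by (simp add: survivor_function_def cumulative_mono)

lemma survivor_nonpos: "t \<le> 0 \<Longrightarrow> survivor t = 1"
  by (simp add: survivor_function_def cumulative_nonpos)

lemma survivor_pos: "0 < survivor t"
  by (simp add: survivor_function_def)

lemma survivor_le_1: "0 \<le> t \<Longrightarrow> survivor t \<le> 1"
  using survivor_antimono[of 0 t] by (simp add: survivor_nonpos)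

lemma survivor_borel [measurable]: "survivor \<in> borel_measurable borel"
proof -
  have "mono (\<lambda>t. - survivor t)" by (auto simp: mono_def survivor_antimono)
  then have "(\<lambda>t. - (- survivor t)) \<in> borel_measurable borel"
    by (intro borel_measurable_uminus borel_measurable_mono)
  then show ?thesis by simp
qed

text \<open>
  Near \<open>t\<close> the hazard rate is bounded, so the cumulative hazard is Lipschitz there.
\<close>

lemma cumulative_isCont: "isCont cumulative t"
proof -
  obtain C where C: "\<And>u. u \<in> {0..\<bar>t\<bar> + 1} \<Longrightarrow> k u \<le> C" using rate_boundE by metis
  have C0: "0 \<le> C" using C[of 0] rate_nonneg[of 0] by auto
  \<comment> \<open>Times before 0 carry no hazard, so only increments between nonnegative times matter.\<close>
  have eq: "cumulative s = cumulative (max 0 s)" for s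
    by (auto simp: max_def cumulative_nonpos)
  have lip: "\<bar>cumulative s - cumulative t\<bar> \<le> C * \<bar>s - t\<bar>" if "\<bar>s - t\<bar> < 1" for s
  proof -
    have le: "\<bar>cumulative q - cumulative p\<bar> \<le> C * \<bar>q - p\<bar>" if "p \<le> q" "q \<le> \<bar>t\<bar> + 1" for p q
    proof -
      have "0 \<le> cumulative (max 0 q) - cumulative (max 0 p)"
        "cumulative (max 0 q) - cumulative (max 0 p) \<le> C * (max 0 q - max 0 p)"
        by (rule cumulative_increment[where C=C]; use that C in auto)+
      moreover have "C * (max 0 q - max 0 p) \<le> C * \<bar>q - p\<bar>"
        using that C0 by (intro mult_left_mono) auto
      ultimately show ?thesis using eq[of p] eq[of q] by linarith
    qed
    show ?thesis using le[of s t] le[of t s] that by (cases "s \<le> t") (auto simp: abs_minus_commute)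
  qed
  have "(cumulative \<longlongrightarrow> cumulative t) (at t)"
  proof (rule Lim_transform_bound[of "\<lambda>s. cumulative s - cumulative t" "\<lambda>s. C * \<bar>s - t\<bar>", THEN Lim_null[THEN iffD2]])
    show "\<forall>\<^sub>F s in at t. norm (cumulative s - cumulative t) \<le> norm (C * \<bar>s - t\<bar>)"
      unfolding eventually_at using lip C0 by (intro exI[of _ 1]) (auto simp: dist_real_def abs_mult)
    show "((\<lambda>s. C * \<bar>s - t\<bar>) \<longlongrightarrow> 0) (at t)"
      by (auto intro!: tendsto_eq_intros)
  qed
  then show ?thesis by (simp add: isCont_def)
qed

lemma survivor_isCont: "isCont survivor t"
  unfolding survivor_function_def by (intro continuous_intros cumulative_isCont)

lemma set_integrable_density:
  assumes "0 \<le> a" shows "set_integrable lborel {a..b} (\<lambda>t. k t * survivor t)"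
proof (rule set_integrable_bound[OF set_integrable_rate[OF assms]])
  show "set_borel_measurable lborel {a..b} (\<lambda>t. k t * survivor t)"
    unfolding set_borel_measurable_def by measurable
  show "AE x in lborel. x \<in> {a..b} \<longrightarrow> norm (k x * survivor x) \<le> norm (k x)"
    using assms by (auto simp: abs_mult survivor_le_1 less_imp_le[OF survivor_pos] intro!: AE_I2 mult_left_le)
qed

lemma set_integrable_density_Ioc:
  assumes "0 \<le> a" shows "set_integrable lborel {a<..b} (\<lambda>t. k t * survivor t)"
  by (rule set_integrable_subset[OF set_integrable_density[OF assms, of b]]) auto

text \<open>
  The fundamental theorem of calculus is not applicable, because the survivor function need not be
  differentiable where the rate is discontinuous. Instead, over an interval \<open>{p<..q}\<close> on which the
  cumulative hazard grows by \<open>x\<close>, both the integral and \<open>survivor p - survivor q\<close> lie between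
  \<open>survivor q * x\<close> and \<open>survivor p * x\<close>. They differ by at most \<open>x\<^sup>2\<close>, which is quadratic in the
  length of the interval. So the integral up to \<open>t\<close>
  plus \<open>survivor t\<close>, as a function \<open>H\<close> of \<open>t\<close>, has derivative zero.
\<close>

lemma integral_density_Ioc:
  assumes ab: "0 \<le> a" "a \<le> b"
  shows "(LBINT t:{a<..b}. k t * survivor t) = survivor a - survivor b"
proof -
  obtain C where C: "\<And>u. u \<in> {0..b} \<Longrightarrow> k u \<le> C" using rate_boundE by metis
  define H where "H t = (LBINT s:{0..t}. k s * survivor s) + survivor t" for t
  have H_diff: "H q - H p = (LBINT t:{p<..q}. k t * survivor t) - (survivor p - survivor q)"
    if "0 \<le> p" "p \<le> q" for p q
  proof -
    have "(LBINT t:{0..q}. k t * survivor t) = (LBINT t:{0..p} \<union> {p<..q}. k t * survivor t)"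
      using that by (simp add: ivl_disj_un)
    also have "\<dots> = (LBINT t:{0..p}. k t * survivor t) + (LBINT t:{p<..q}. k t * survivor t)"
      by (rule set_integral_Un)
         (use that in \<open>auto intro: set_integrable_density set_integrable_density_Ioc\<close>)
    finally show ?thesis by (simp add: H_def)
  qed
  have quad: "\<bar>H q - H p\<bar> \<le> C\<^sup>2 * (q - p)\<^sup>2" if pq: "0 \<le> p" "p \<le> q" "q \<le> b" for p q
  proof -
    define x where "x = cumulative q - cumulative p"
    have x: "0 \<le> x" "x \<le> C * (q - p)"
      unfolding x_def by (rule cumulative_increment[where C=C]; use pq C in auto)+
    have sq: "survivor q = survivor p * exp (- x)"
      by (simp add: survivor_function_def x_def flip: exp_add)
    have p1: "survivor p \<le> 1" "0 < survivor p" using survivor_le_1 pq survivor_pos by auto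
    let ?I = "LBINT t:{p<..q}. k t * survivor t"
    have i1: "?I \<le> (LBINT t:{p<..q}. k t * survivor p)"
      by (rule set_integral_mono)
         (use pq in \<open>auto intro!: set_integrable_density_Ioc set_integrable_mult_left set_integrable_rate_Ioc
            mult_left_mono survivor_antimono rate_nonneg\<close>)
    have i2: "(LBINT t:{p<..q}. k t * survivor q) \<le> ?I"
      by (rule set_integral_mono)
         (use pq in \<open>auto intro!: set_integrable_density_Ioc set_integrable_mult_left set_integrable_rate_Ioc
            mult_left_mono survivor_antimono rate_nonneg\<close>)
    have i3: "survivor q * x \<le> ?I" "?I \<le> survivor p * x"
      using i1 i2 cumulative_diff[OF pq(1,2)] by (simp_all add: x_def mult.commute)
    \<comment> \<open>Elementary bounds that place the decrease of the survivor function in the same range.\<close>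
    have e1: "1 - exp (- x) \<le> x" using exp_ge_add_one_self[of "- x"] by linarith
    have e2: "exp (- x) * x \<le> 1 - exp (- x)"
    proof -
      have "exp (- x) * (1 + x) \<le> exp (- x) * exp x"
        by (intro mult_left_mono exp_ge_add_one_self) auto
      then show ?thesis by (simp add: algebra_simps flip: exp_add)
    qed
    have d1: "survivor p - survivor q \<le> survivor p * x" "survivor q * x \<le> survivor p - survivor q"
      using mult_left_mono[OF e1, of "survivor p"] mult_left_mono[OF e2, of "survivor p"] p1
      by (simp_all add: sq algebra_simps)
    have "\<bar>H q - H p\<bar> \<le> survivor p * x - survivor q * x"
      unfolding H_diff[OF pq(1,2)] using i3 d1 by linarith
    also have "\<dots> = survivor p * ((1 - exp (- x)) * x)" by (simp add: sq algebra_simps)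
    also have "\<dots> \<le> 1 * (x * x)"
      using p1 e1 x by (intro mult_mono mult_right_mono) auto
    also have "\<dots> \<le> (C * (q - p)) * (C * (q - p))"
      using x by (auto intro!: mult_mono)
    finally show ?thesis by (simp add: power2_eq_square algebra_simps)
  qed
  have "\<exists>c. \<forall>x\<in>{0..b}. H x = c"
  proof (rule has_field_derivative_zero_constant)
    fix x assume x: "x \<in> {0..b}"
    have "((\<lambda>y. (H y - H x) / (y - x)) \<longlongrightarrow> 0) (at x within {0..b})"
    proof (rule Lim_transform_bound[where g="\<lambda>y. C\<^sup>2 * \<bar>y - x\<bar>"])
      have "norm ((H y - H x) / (y - x)) \<le> norm (C\<^sup>2 * \<bar>y - x\<bar>)" if "y \<in> {0..b}" "y \<noteq> x" for y
      proof -
        have "\<bar>H y - H x\<bar> \<le> C\<^sup>2 * (y - x)\<^sup>2"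
          using quad[of x y] quad[of y x] x that
          by (cases "x \<le> y") (auto simp: abs_minus_commute power2_commute)
        then show ?thesis using that
          by (simp add: divide_simps abs_mult power2_eq_square mult.assoc)
      qed
      then show "\<forall>\<^sub>F y in at x within {0..b}. norm ((H y - H x) / (y - x)) \<le> norm (C\<^sup>2 * \<bar>y - x\<bar>)"
        unfolding eventually_at by (intro exI[of _ 1]) auto
      show "((\<lambda>y. C\<^sup>2 * \<bar>y - x\<bar>) \<longlongrightarrow> 0) (at x within {0..b})"
        by (auto intro!: tendsto_eq_intros)
    qed
    then show "(H has_field_derivative 0) (at x within {0..b})"
      by (simp add: has_field_derivative_iff)
  qed simp
  then have "H a = H b" using ab by auto
  then show ?thesis using H_diff[OF ab] by simp
qed

lemma nn_integral_density_Ioc: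
  assumes ab: "0 \<le> a" "a \<le> b"
  shows "(\<integral>\<^sup>+t\<in>{a<..b}. ennreal (k t * survivor t) \<partial>lborel) = ennreal (survivor a - survivor b)"
proof -
  have "(\<integral>\<^sup>+t\<in>{a<..b}. ennreal (k t * survivor t) \<partial>lborel)
      = (\<integral>\<^sup>+t. ennreal (indicator {a<..b} t *\<^sub>R (k t * survivor t)) \<partial>lborel)"
    by (intro nn_integral_cong) (auto simp: indicator_def)
  also have "\<dots> = ennreal (LBINT t:{a<..b}. k t * survivor t)"
    unfolding set_lebesgue_integral_def
    by (rule nn_integral_eq_integral)
       (use set_integrable_density_Ioc[OF ab(1)] in \<open>auto simp: set_integrable_def rate_nonneg less_imp_le[OF survivor_pos]\<close>)
  finally show ?thesis using integral_density_Ioc[OF ab] by simp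
qed

lemma killing_density_borel [measurable]: "killing_density \<in> borel_measurable borel"
  unfolding lifetime_density_def by measurable

text \<open>
  The two measures agree on the half-open intervals, by \<open>integral_density_Ioc\<close>. To the left of 0
  both vanish, which is why an interval may be cut off at 0 with \<open>max 0\<close>.
\<close>

lemma interval_measure_survivor:
  "interval_measure (\<lambda>t. - survivor t) = density lborel killing_density"
proof (rule measure_eqI_generator_eq_countable)
  let ?E = "range (\<lambda>(a, b). {a <.. b::real})"
  show "Int_stable ?E" 
    by (auto simp: Int_stable_def)
  show "sets (interval_measure (\<lambda>t. - survivor t)) = sigma_sets UNIV ?E"
    "sets (density lborel killing_density) = sigma_sets UNIV ?E"
    by (simp_all add: borel_sigma_sets_Ioc)
  have em: "emeasure (interval_measure (\<lambda>t. - survivor t)) {a<..b}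
     = (if a \<le> b then ennreal (survivor a - survivor b) else 0)" for a b
    by (subst emeasure_interval_measure_Ioc_eq)
       (auto intro: survivor_antimono continuous_at_imp_continuous_at_within survivor_isCont continuous_intros)
  show "emeasure (interval_measure (\<lambda>t. - survivor t)) X = emeasure (density lborel killing_density) X"
    if XE: "X \<in> ?E" for X
  proof -
    obtain a b where X: "X = {a<..b}" using XE by auto
    have surv: "survivor (max 0 t) = survivor t" for t by (auto simp: max_def survivor_nonpos)
    show ?thesis
    proof (cases "a \<le> b")
      case True
      have "emeasure (density lborel killing_density) X = (\<integral>\<^sup>+t. killing_density t * indicator {a<..b} t \<partial>lborel)"
        unfolding X by (rule emeasure_density) auto
      also have "\<dots> = (\<integral>\<^sup>+t\<in>{max 0 a<..max 0 b}. ennreal (k t * survivor t) \<partial>lborel)"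
        using AE_lborel_singleton[of 0]
        by (intro nn_integral_cong_AE) (auto simp: lifetime_density_def indicator_def max_def elim!: AE_mp)
      also have "\<dots> = ennreal (survivor a - survivor b)"
        using True by (subst nn_integral_density_Ioc) (auto simp: surv)
      finally show ?thesis using em True X by simp
    next
      case False then show ?thesis using X by simp
    qed
  qed
  show "range (\<lambda>n::nat. {- real n <.. real n}) \<subseteq> ?E" by auto
  show "\<Union> (range (\<lambda>n::nat. {- real n <.. real n})) = UNIV"
  proof (intro set_eqI iffI UNIV_I)
    fix x :: real
    obtain n :: nat where "\<bar>x\<bar> < real n" using reals_Archimedean2 by blast
    then show "x \<in> \<Union> (range (\<lambda>n::nat. {- real n <.. real n}))" by (auto intro!: exI[of _ n])
  qed
  show "emeasure (interval_measure (\<lambda>t. - survivor t)) a \<noteq> \<infinity>"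
    if "a \<in> range (\<lambda>n::nat. {- real n <.. real n})" for a
    using that em by auto
qed auto

text \<open>
  The mass of \<open>{0<..t}\<close> is \<open>1 - survivor t\<close>. If no mass escapes to infinity, the complement
  carries the rest.
\<close>

lemma tail_of_lifetime_density:
  assumes total: "(\<integral>\<^sup>+t. killing_density t \<partial>lborel) = 1" and t: "0 \<le> t"
  shows "(\<integral>\<^sup>+s. indicator {t<..} s * killing_density s \<partial>lborel) = ennreal (survivor t)"
proof -
  let ?T = "\<integral>\<^sup>+s. indicator {t<..} s * killing_density s \<partial>lborel"
  have "(\<integral>\<^sup>+s. killing_density s \<partial>lborel)
      = (\<integral>\<^sup>+s. (\<lambda>s. indicator {0<..t} s * killing_density s) s + indicator {t<..} s * killing_density s \<partial>lborel)"
    using AE_lborel_singleton[of 0] t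
    by (intro nn_integral_cong_AE) (auto simp: lifetime_density_def indicator_def elim!: AE_mp)
  also have "\<dots> = (\<integral>\<^sup>+s. indicator {0<..t} s * killing_density s \<partial>lborel) + ?T"
    by (intro nn_integral_add) auto
  also have "(\<integral>\<^sup>+s. indicator {0<..t} s * killing_density s \<partial>lborel)
      = (\<integral>\<^sup>+s\<in>{0<..t}. ennreal (k s * survivor s) \<partial>lborel)"
    by (intro nn_integral_cong) (auto simp: lifetime_density_def indicator_def)
  also have "\<dots> = ennreal (1 - survivor t)"
    using t by (simp add: nn_integral_density_Ioc survivor_nonpos)
  finally have "ennreal (1 - survivor t) + ?T = 1" using total by simp
  also have "1 = ennreal (1 - survivor t) + ennreal (survivor t)"
    using survivor_le_1[OF t] survivor_pos[of t] by (simp flip: ennreal_plus)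
  finally show ?thesis by (subst (asm) ennreal_add_left_cancel) auto
qed

text \<open>
  The mass up to time \<open>n\<close> is \<open>1 - survivor n\<close>. A deficit is possible: it is the probability
  of never dying.
\<close>

lemma total_lifetime_density_le_1: "(\<integral>\<^sup>+t. killing_density t \<partial>lborel) \<le> 1"
proof (rule LIMSEQ_le_const2)
  show "(\<lambda>n. \<integral>\<^sup>+t. killing_density t * indicator {..real n} t \<partial>lborel)
     \<longlonglongrightarrow> (\<integral>\<^sup>+t. killing_density t \<partial>lborel)"
  proof (rule nn_integral_LIMSEQ)
    show "incseq (\<lambda>n t. killing_density t * indicator {..real n} t)"
      by (auto simp: incseq_def le_fun_def indicator_def)
    fix t :: real
    obtain N :: nat where N: "t < real N" using reals_Archimedean2 by blast
    have "\<forall>\<^sub>F n in sequentially. killing_density t * indicator {..real n} t = killing_density t"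
      using eventually_ge_at_top[of N] by eventually_elim (use N in \<open>auto simp: indicator_def\<close>)
    then show "(\<lambda>n. killing_density t * indicator {..real n} t) \<longlonglongrightarrow> killing_density t"
      by (rule tendsto_eventually)
  qed auto
  have "(\<integral>\<^sup>+t. killing_density t * indicator {..real n} t \<partial>lborel) \<le> 1" for n
  proof -
    have "(\<integral>\<^sup>+t. killing_density t * indicator {..real n} t \<partial>lborel)
      = (\<integral>\<^sup>+s\<in>{0<..real n}. ennreal (k s * survivor s) \<partial>lborel)"
      using AE_lborel_singleton[of 0]
      by (intro nn_integral_cong_AE) (auto simp: lifetime_density_def indicator_def elim!: AE_mp)
    also have "\<dots> \<le> 1"
      using survivor_pos[of "real n"] by (subst nn_integral_density_Ioc) (auto simp: survivor_nonpos)
    finally show ?thesis .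
  qed
  then show "\<exists>N. \<forall>n\<ge>N. (\<integral>\<^sup>+t. killing_density t * indicator {..real n} t \<partial>lborel) \<le> 1" by blast
qed

end


section \<open>Paths with a killing time\<close>
lemma space_path_space: "space path_space = {w \<in> extensional {0..}. cadlag w}"
  by (auto simp: path_space_def space_restrict_space space_PiM PiE_def)

lemma space_killed_path_space:
  "space killed_path_space = {w \<in> extensional {0..}. cadlag w \<and>
     (\<forall>s\<ge>0. killing_time w \<le> ereal s \<longrightarrow> w s = w (real_of_ereal (killing_time w)))}"
  by (auto simp: killed_path_space_def space_restrict_space space_PiM PiE_def)

lemma coordinate_path_measurable:
  assumes "0 \<le> s" shows "(\<lambda>w. w s) \<in> path_space \<rightarrow>\<^sub>M borel"
  unfolding path_space_def
  by (intro measurable_restrict_space1 measurable_component_singleton) (use assms in auto)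

lemma coordinate_killed_path_measurable:
  assumes "0 \<le> s" shows "(\<lambda>w. w s) \<in> killed_path_space \<rightarrow>\<^sub>M borel"
  unfolding killed_path_space_def
  by (intro measurable_restrict_space1 measurable_component_singleton) (use assms in auto)

lemma measurable_into_killed_path_space:
  assumes "\<And>x. x \<in> space M \<Longrightarrow> f x \<in> space killed_path_space"
    and "\<And>s. 0 \<le> s \<Longrightarrow> (\<lambda>x. f x s) \<in> M \<rightarrow>\<^sub>M borel"
  shows "f \<in> M \<rightarrow>\<^sub>M killed_path_space"
  unfolding killed_path_space_def
proof (intro measurable_restrict_space2 measurable_PiM_single')
  show "f \<in> space M \<rightarrow> {w. cadlag w \<and>
      (\<forall>s\<ge>0. killing_time w \<le> ereal s \<longrightarrow> w s = w (real_of_ereal (killing_time w)))}"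
    using assms(1) by (auto simp: space_killed_path_space)
  show "f \<in> space M \<rightarrow> {0..} \<rightarrow>\<^sub>E space borel"
    using assms(1) by (auto simp: space_killed_path_space PiE_def)
qed (use assms(2) in auto)

lemma grid_point_above_tendsto:
  fixes t :: real
  shows "filterlim (\<lambda>n. (real_of_int \<lfloor>t * real (Suc n)\<rfloor> + 1) / real (Suc n)) (at_right t) sequentially"
proof (rule tendsto_imp_filterlim_at_right)
  let ?u = "\<lambda>n. (real_of_int \<lfloor>t * real (Suc n)\<rfloor> + 1) / real (Suc n)"
  show "?u \<longlonglongrightarrow> t"
  proof (rule tendsto_sandwich[where f="\<lambda>n. t" and h="\<lambda>n. t + 1 / real (Suc n)"])
    show "\<forall>\<^sub>F n in sequentially. t \<le> ?u n"
      by (intro always_eventually allI less_imp_le) (simp add: pos_less_divide_eq del: of_nat_Suc)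
    show "\<forall>\<^sub>F n in sequentially. ?u n \<le> t + 1 / real (Suc n)"
      by (intro always_eventually allI) (simp add: field_simps del: of_nat_Suc)
    show "(\<lambda>n. t + 1 / real (Suc n)) \<longlonglongrightarrow> t"
      using tendsto_add[OF tendsto_const LIMSEQ_inverse_real_of_nat, of t] by (simp add: inverse_eq_divide)
  qed simp
  show "\<forall>\<^sub>F n in sequentially. t < ?u n"
    by (intro always_eventually allI) (simp add: pos_less_divide_eq)
qed

text \<open>
  Right-continuity makes \<open>w t\<close> the limit of the values at the grid points \<open>(\<lfloor>t n\<rfloor> + 1) / n\<close>, which
  lie strictly to the right of \<open>t\<close>. For each \<open>n\<close> there are countably many of them, so each
  approximation is jointly measurable. Cutting off at 0 extends the evaluation to all real times,
  so that \<open>lborel\<close> can be the measure on the time axis.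
\<close>

lemma evaluation_measurable:
  "(\<lambda>(w, t). w (max 0 t)) \<in> (path_space :: (real \<Rightarrow> 'b::polish_space) measure) \<Otimes>\<^sub>M borel \<rightarrow>\<^sub>M borel"
proof (rule borel_measurable_LIMSEQ_metric)
  let ?u = "\<lambda>n t. (real_of_int \<lfloor>max 0 t * real (Suc n)\<rfloor> + 1) / real (Suc n)"
  let ?M = "(path_space :: (real \<Rightarrow> 'b::polish_space) measure) \<Otimes>\<^sub>M (borel :: real measure)"
  show "(\<lambda>(w, t). w (?u n t)) \<in> borel_measurable ?M" for n
  proof -
    have "(\<lambda>x. (\<lambda>i x. fst x ((real i + 1) / real (Suc n))) (nat \<lfloor>max 0 (snd x) * real (Suc n)\<rfloor>) x)
        \<in> borel_measurable ?M"
    proof (rule measurable_compose_countable[where f="\<lambda>i x. fst x ((real i + 1) / real (Suc n))"])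
      show "(\<lambda>x. fst x ((real i + 1) / real (Suc n))) \<in> borel_measurable ?M" for i
        by (rule measurable_compose[OF measurable_fst coordinate_path_measurable]) auto
    qed measurable
    then show ?thesis by (simp add: case_prod_beta of_nat_nat)
  qed
  show "(\<lambda>n. (\<lambda>(w, t). w (?u n t)) x) \<longlonglongrightarrow> (\<lambda>(w, t). w (max 0 t)) x" if "x \<in> space ?M" for x
  proof -
    obtain w t where x: "x = (w, t)" "w \<in> space path_space"
      using \<open>x \<in> space ?M\<close> by (auto simp: space_pair_measure)
    then have "(w \<longlongrightarrow> w (max 0 t)) (at_right (max 0 t))"
      by (auto simp: space_path_space cadlag_def)
    from filterlim_compose[OF this grid_point_above_tendsto]
    show ?thesis by (simp add: x)
  qed
qed

text \<open>
  A cadlag path stays near one of its one-sided limits just before and just after each time, so a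
  locally bounded rate is bounded on a neighbourhood of each time. A compact interval needs finitely
  many of these neighbourhoods.
\<close>

lemma rate_along_path_bounded:
  fixes w :: "real \<Rightarrow> 'b::topological_space"
  assumes w: "cadlag w" and \<kappa>: "locally_bounded \<kappa>"
  shows "\<exists>C. \<forall>s\<in>{0..T}. \<kappa> (w s) \<le> C"
proof (cases "0 \<le> T")
  case False then show ?thesis by auto
next
  case True
  have near: "\<exists>U C. open U \<and> y \<in> U \<and> (\<forall>z\<in>U. \<kappa> z \<le> C)" for y
  proof -
    obtain U where "open U" "y \<in> U" "bounded (\<kappa> ` U)" using \<kappa> unfolding locally_bounded_def by blast
    moreover obtain C where "\<forall>z\<in>U. \<bar>\<kappa> z\<bar> \<le> C"
      using \<open>bounded (\<kappa> ` U)\<close> by (auto simp: bounded_iff)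
    ultimately show ?thesis by (intro exI[of _ U] exI[of _ C]) force
  qed
  have right: "\<exists>C d. 0 < d \<and> (\<forall>s. t < s \<and> s < t + d \<longrightarrow> \<kappa> (w s) \<le> C)" if "0 \<le> t" for t
  proof -
    obtain U C where U: "open U" "w t \<in> U" "\<forall>z\<in>U. \<kappa> z \<le> C" using near by blast
    have "\<forall>\<^sub>F s in at_right t. w s \<in> U"
      using w U that unfolding cadlag_def by (blast dest: topological_tendstoD)
    then obtain b where "t < b" "\<forall>s. t < s \<and> s < b \<longrightarrow> w s \<in> U"
      by (auto simp: eventually_at_right_field)
    then show ?thesis using U by (intro exI[of _ C] exI[of _ "b - t"]) auto
  qed
  have left: "\<exists>C d. 0 < d \<and> (\<forall>s. 0 \<le> s \<and> t - d < s \<and> s < t \<longrightarrow> \<kappa> (w s) \<le> C)" if "0 \<le> t" for t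
  proof (cases "t = 0")
    case True then show ?thesis by (intro exI[of _ 0] exI[of _ 1]) auto
  next
    case False
    then have "0 < t" using that by simp
    then obtain l where l: "(w \<longlongrightarrow> l) (at_left t)" using w by (auto simp: cadlag_def)
    obtain U C where U: "open U" "l \<in> U" "\<forall>z\<in>U. \<kappa> z \<le> C" using near by blast
    have "\<forall>\<^sub>F s in at_left t. w s \<in> U" using l U by (blast dest: topological_tendstoD)
    then obtain b where "b < t" "\<forall>s. b < s \<and> s < t \<longrightarrow> w s \<in> U"
      by (auto simp: eventually_at_left_field)
    then show ?thesis using U by (intro exI[of _ C] exI[of _ "t - b"]) auto
  qed
  \<comment> \<open>Restricting to nonnegative times lets the local step at the left endpoint look below 0.\<close>
  define P where "P a b \<longleftrightarrow> (\<exists>C. \<forall>s. 0 \<le> s \<and> a \<le> s \<and> s \<le> b \<longrightarrow> \<kappa> (w s) \<le> C)" for a b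
  have "P 0 T"
  proof (rule Bolzano[OF True])
    fix a b c assume "P a b" "P b c"
    then obtain C D where "\<forall>s. 0 \<le> s \<and> a \<le> s \<and> s \<le> b \<longrightarrow> \<kappa> (w s) \<le> C"
      "\<forall>s. 0 \<le> s \<and> b \<le> s \<and> s \<le> c \<longrightarrow> \<kappa> (w s) \<le> D" by (auto simp: P_def)
    then have "\<forall>s. 0 \<le> s \<and> a \<le> s \<and> s \<le> c \<longrightarrow> \<kappa> (w s) \<le> max C D"
      by (meson linear max.coboundedI1 max.coboundedI2)
    then show "P a c" unfolding P_def by blast
  next
    fix x :: real assume "0 \<le> x"
    obtain C d where C: "0 < d" "\<forall>s. x < s \<and> s < x + d \<longrightarrow> \<kappa> (w s) \<le> C"
      using right[OF \<open>0 \<le> x\<close>] by blast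
    obtain D e where D: "0 < e" "\<forall>s. 0 \<le> s \<and> x - e < s \<and> s < x \<longrightarrow> \<kappa> (w s) \<le> D"
      using left[OF \<open>0 \<le> x\<close>] by blast
    have "P a b" if "a \<le> x" "x \<le> b" "b - a < min d e" for a b
    proof -
      have "\<kappa> (w s) \<le> max (\<kappa> (w x)) (max C D)" if "0 \<le> s" "a \<le> s" "s \<le> b" for s
      proof (cases s x rule: linorder_cases)
        case less
        then have "\<kappa> (w s) \<le> D" using D(2) that \<open>x \<le> b\<close> \<open>b - a < min d e\<close> by auto
        then show ?thesis by simp
      next
        case greater
        then have "\<kappa> (w s) \<le> C" using C(2) that \<open>a \<le> x\<close> \<open>b - a < min d e\<close> by auto
        then show ?thesis by simp
      qed simp
      then show ?thesis unfolding P_def by blast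
    qed
    then show "\<exists>d>0. \<forall>a b. a \<le> x \<and> x \<le> b \<and> b - a < d \<longrightarrow> P a b"
      using C D by (intro exI[of _ "min d e"]) auto
  qed
  then show ?thesis unfolding P_def by (meson atLeastAtMost_iff)
qed

lemma killing_time_alive_path [simp]: "killing_time (alive_path w) = \<infinity>"
proof -
  have "{t. 0 \<le> t \<and> alive_path w t \<in> {True} \<times> UNIV} = {}" by (auto simp: alive_path_def)
  then show ?thesis unfolding killing_time_def by (simp only: image_empty Inf_empty top_ereal_def)
qed

definition killed_path :: "(real \<Rightarrow> 'a) \<Rightarrow> real \<Rightarrow> real \<Rightarrow> bool \<times> 'a" where
  "killed_path w t = (\<lambda>s\<in>{0..}. if s < t then (False, w s) else (True, w t))"

lemma kill_alive_path: "0 \<le> t \<Longrightarrow> kill t (alive_path w) = killed_path w t"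
  unfolding kill_def killing_time_alive_path
  by (auto simp: killed_path_def alive_path_def fun_eq_iff)

lemma killed_path_apply: "0 \<le> s \<Longrightarrow> killed_path w t s = (if s < t then (False, w s) else (True, w t))"
  by (simp add: killed_path_def)

lemma killing_time_killed_path [simp]: "0 \<le> t \<Longrightarrow> killing_time (killed_path w t) = ereal t"
proof -
  assume t: "0 \<le> t"
  have "{s. 0 \<le> s \<and> killed_path w t s \<in> {True} \<times> UNIV} = {t..}"
    using t by (auto simp: killed_path_def split: if_splits)
  then show ?thesis unfolding killing_time_def by (auto intro!: INF_eqI)
qed

lemma killing_location_killed_path [simp]: "0 \<le> t \<Longrightarrow> killing_location (killed_path w t) = w t"
  by (simp add: killing_location_def killed_path_apply)

lemma cadlag_continuous_image:
  assumes w: "cadlag w" and g: "continuous_on UNIV g"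
  shows "cadlag (\<lambda>s\<in>{0..}. g (w s))"
  unfolding cadlag_def
proof (intro conjI allI impI)
  let ?v = "\<lambda>s\<in>{0..}. g (w s)"
  have g_lim: "((\<lambda>s. g (w s)) \<longlongrightarrow> g l) F" if "(w \<longlongrightarrow> l) F" for l F
    using continuous_on_tendsto_compose[OF g that] by simp
  fix t :: real
  {
    assume t: "0 \<le> t"
    then have "((\<lambda>s. g (w s)) \<longlongrightarrow> g (w t)) (at_right t)" using w g_lim by (auto simp: cadlag_def)
    moreover have "\<forall>\<^sub>F s in at_right t. g (w s) = ?v s"
      using t by (auto simp: eventually_at_right_field intro!: exI[of _ "t + 1"])
    ultimately have "(?v \<longlongrightarrow> g (w t)) (at_right t)" by (rule Lim_transform_eventually)
    then show "(?v \<longlongrightarrow> ?v t) (at_right t)" using t by simp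
  next
    assume t: "0 < t"
    then obtain l where "(w \<longlongrightarrow> l) (at_left t)" using w by (auto simp: cadlag_def)
    then have "((\<lambda>s. g (w s)) \<longlongrightarrow> g l) (at_left t)" by (rule g_lim)
    moreover have "\<forall>\<^sub>F s in at_left t. g (w s) = ?v s"
      using t by (auto simp: eventually_at_left_field intro!: exI[of _ 0])
    ultimately show "\<exists>l. (?v \<longlongrightarrow> l) (at_left t)" by (blast intro: Lim_transform_eventually)
  }
qed

lemma cadlag_alive_path: "cadlag w \<Longrightarrow> cadlag (alive_path w)"
  unfolding alive_path_def by (rule cadlag_continuous_image) (auto intro: continuous_intros)

lemma cadlag_killed_path:
  assumes "cadlag w" "0 \<le> u" shows "cadlag (killed_path w u)"
  unfolding cadlag_def
proof (intro conjI allI impI)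
  have alive: "cadlag (alive_path w)" using assms cadlag_alive_path by blast
  fix t :: real assume t: "0 \<le> t"
  show "(killed_path w u \<longlongrightarrow> killed_path w u t) (at_right t)"
  proof (cases "t < u")
    case True
    have "\<forall>\<^sub>F s in at_right t. alive_path w s = killed_path w u s"
      using True t by (auto simp: eventually_at_right_field alive_path_def killed_path_def intro!: exI[of _ u])
    moreover have "(alive_path w \<longlongrightarrow> alive_path w t) (at_right t)"
      using alive t by (auto simp: cadlag_def)
    moreover have "alive_path w t = killed_path w u t"
      using True t by (auto simp: alive_path_def killed_path_def)
    ultimately show ?thesis by (auto dest: Lim_transform_eventually)
  next
    case False
    have "\<forall>\<^sub>F s in at_right t. killed_path w u t = killed_path w u s"
      using False t by (auto simp: eventually_at_right_field killed_path_def intro!: exI[of _ "t + 1"])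
    then show ?thesis by (rule Lim_transform_eventually[OF tendsto_const])
  qed
next
  have alive: "cadlag (alive_path w)" using assms cadlag_alive_path by blast
  fix t :: real assume t: "0 < t"
  show "\<exists>l. (killed_path w u \<longlongrightarrow> l) (at_left t)"
  proof (cases "t \<le> u")
    case True
    have "\<forall>\<^sub>F s in at_left t. alive_path w s = killed_path w u s"
      using True t by (auto simp: eventually_at_left_field alive_path_def killed_path_def intro!: exI[of _ 0])
    moreover obtain l where "(alive_path w \<longlongrightarrow> l) (at_left t)"
      using alive t by (auto simp: cadlag_def)
    ultimately show ?thesis by (blast dest: Lim_transform_eventually)
  next
    case False
    have "\<forall>\<^sub>F s in at_left t. killed_path w u t = killed_path w u s"
      using False t assms by (auto simp: eventually_at_left_field killed_path_def intro!: exI[of _ u])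
    then show ?thesis by (blast intro: Lim_transform_eventually[OF tendsto_const])
  qed
qed

lemma alive_path_in_space: "cadlag w \<Longrightarrow> alive_path w \<in> space killed_path_space"
  by (simp add: space_killed_path_space cadlag_alive_path) (simp add: alive_path_def)

lemma killed_path_in_space: "cadlag w \<Longrightarrow> 0 \<le> t \<Longrightarrow> killed_path w t \<in> space killed_path_space"
  by (auto simp: space_killed_path_space cadlag_killed_path killed_path_apply)
     (simp add: killed_path_def)

lemma measurable_Pair_const: "Pair c \<in> borel \<rightarrow>\<^sub>M borel"
  by (intro borel_measurable_continuous_onI continuous_intros)

lemma alive_path_measurable: "alive_path \<in> path_space \<rightarrow>\<^sub>M killed_path_space"
proof (rule measurable_into_killed_path_space)
  show "(\<lambda>w. alive_path w s) \<in> path_space \<rightarrow>\<^sub>M borel" if "0 \<le> s" for s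
    using measurable_compose[OF coordinate_path_measurable[OF that] measurable_Pair_const, of False] that
    by (simp add: alive_path_def)
qed (auto simp: space_path_space alive_path_in_space)

text \<open>
  The cylinder \<open>\<sigma>\<close>-algebra reduces this to one coordinate at a time, where the killed path is
  either alive at a fixed time or at its killing location, a jointly measurable evaluation.
\<close>

lemma killed_path_measurable:
  "(\<lambda>(w, t). killed_path w (max 0 t))
    \<in> (path_space :: (real \<Rightarrow> 'b::polish_space) measure) \<Otimes>\<^sub>M borel \<rightarrow>\<^sub>M killed_path_space"
proof (rule measurable_into_killed_path_space)
  let ?M = "(path_space :: (real \<Rightarrow> 'b::polish_space) measure) \<Otimes>\<^sub>M (borel :: real measure)"
  fix s :: real assume s: "0 \<le> s"
  have "(\<lambda>x. if s < max 0 (snd x) then (False, fst x s) else (True, (\<lambda>(w, t). w (max 0 t)) x)) \<in> ?M \<rightarrow>\<^sub>M borel"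
  proof (rule measurable_If)
    show "(\<lambda>x. (False, fst x s)) \<in> ?M \<rightarrow>\<^sub>M borel"
      by (rule measurable_compose[OF measurable_compose[OF measurable_fst
            coordinate_path_measurable[OF s]] measurable_Pair_const])
    show "(\<lambda>x. (True, (\<lambda>(w, t). w (max 0 t)) x)) \<in> ?M \<rightarrow>\<^sub>M borel"
      by (rule measurable_compose[OF evaluation_measurable measurable_Pair_const])
  qed measurable
  then show "(\<lambda>x. (case x of (w, t) \<Rightarrow> killed_path w (max 0 t)) s) \<in> ?M \<rightarrow>\<^sub>M borel"
    using s by (simp add: case_prod_beta killed_path_apply if_distrib cong: if_cong)
qed (auto simp: space_pair_measure space_path_space killed_path_in_space)

lemma trapped_after_killing:
  assumes "w \<in> space killed_path_space" "0 \<le> u" "killing_time w \<le> ereal u"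
  shows "w u = w (real_of_ereal (killing_time w))"
  using assms by (auto simp: space_killed_path_space)

text \<open>
  Because of the trap, a path is in the killed half of the state space exactly from its killing
  time on, and there it rests at the killing location. Both functionals of the path, defined
  through an infimum over an uncountable set of times, can thus be read off single coordinates.
\<close>

lemma killing_time_le_iff:
  assumes w: "w \<in> space killed_path_space" and t: "0 \<le> t"
  shows "killing_time w \<le> ereal t \<longleftrightarrow> fst (w t)"
proof
  let ?D = "{t. 0 \<le> t \<and> w t \<in> {True} \<times> UNIV}"
  have le: "killing_time w \<le> ereal u" if "0 \<le> u" "fst (w u)" for u
    unfolding killing_time_def using that by (intro Inf_lower) (auto simp: mem_Times_iff)
  show "killing_time w \<le> ereal t" if "fst (w t)" using le[OF t that] .
  assume a: "killing_time w \<le> ereal t"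
  have "?D \<noteq> {}"
  proof
    assume empty: "?D = {}"
    have "killing_time w = \<infinity>"
      unfolding killing_time_def empty image_empty Inf_empty top_ereal_def ..
    then show False using a by simp
  qed
  then obtain u where u: "0 \<le> u" "fst (w u)" by (auto simp: mem_Times_iff)
  have "w t = w u" using trapped_after_killing[OF w t a] trapped_after_killing[OF w u(1) le[OF u]] by simp
  then show "fst (w t)" using u by simp
qed

lemma killing_location_eq:
  assumes "w \<in> space killed_path_space" "0 \<le> t" "fst (w t)"
  shows "killing_location w = snd (w t)"
  using trapped_after_killing[of w t] killing_time_le_iff[of w t] assms
  by (simp add: killing_location_def)

lemma killed_coordinates_measurable:
  assumes "0 \<le> t"
  shows "(\<lambda>w :: real \<Rightarrow> bool \<times> 'a::topological_space. snd (w t)) \<in> killed_path_space \<rightarrow>\<^sub>M borel"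
    and "Measurable.pred killed_path_space (\<lambda>w :: real \<Rightarrow> bool \<times> 'a. fst (w t))"
proof -
  show "(\<lambda>w :: real \<Rightarrow> bool \<times> 'a. snd (w t)) \<in> killed_path_space \<rightarrow>\<^sub>M borel"
    by (rule measurable_compose[OF coordinate_killed_path_measurable[OF assms]])
       (intro borel_measurable_continuous_onI continuous_intros)
  have "open (fst -` {True} :: (bool \<times> 'a) set)" by (intro open_vimage continuous_on_fst continuous_on_id) (rule Topological_Spaces.open_discrete)
  then have "Measurable.pred borel (fst :: bool \<times> 'a \<Rightarrow> bool)"
    unfolding pred_def by (intro borel_open) (simp add: vimage_def)
  then show "Measurable.pred killed_path_space (\<lambda>w. fst (w t :: bool \<times> 'a))"
    by (rule measurable_compose[OF coordinate_killed_path_measurable[OF assms]])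
qed

text \<open>
  A path that is killed in finite time has come to rest by some integer time, and its position there
  is the killing location. This expresses the event by countably many coordinates.
\<close>

lemma killed_at_location_measurable:
  fixes A :: "'a::topological_space set"
  assumes [measurable]: "A \<in> sets borel"
  shows "{w \<in> space killed_path_space. killing_time w < \<infinity> \<and> killing_location w \<in> A} \<in> sets killed_path_space"
proof -
  have "killing_time w < \<infinity> \<and> killing_location w \<in> A \<longleftrightarrow> (\<exists>n::nat. fst (w (real n)) \<and> snd (w (real n)) \<in> A)"
    if w: "w \<in> space killed_path_space" for w :: "real \<Rightarrow> bool \<times> 'a"
  proof safe
    assume "killing_time w < \<infinity>" and A: "killing_location w \<in> A"
    then obtain n :: nat where "killing_time w < ereal (real n)"
      using less_PInf_Ex_of_nat by auto
    then have "fst (w (real n))" using killing_time_le_iff[OF w, of "real n"] by (simp add: less_imp_le)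
    then show "\<exists>n::nat. fst (w (real n)) \<and> snd (w (real n)) \<in> A"
      using A killing_location_eq[OF w, of "real n"] by auto
  next
    fix n :: nat assume n: "fst (w (real n))" "snd (w (real n)) \<in> A"
    show "killing_location w \<in> A" using killing_location_eq[OF w, of "real n"] n by simp
    have "killing_time w \<le> ereal (real n)" using killing_time_le_iff[OF w, of "real n"] n by simp
    then show "killing_time w < \<infinity>" by (rule le_less_trans) simp
  qed
  then have "{w \<in> space killed_path_space. killing_time w < \<infinity> \<and> killing_location w \<in> A}
     = {w \<in> space killed_path_space. \<exists>n::nat. fst (w (real n)) \<and> snd (w (real n)) \<in> A}"
    by auto
  also have "\<dots> \<in> sets killed_path_space"
  proof -
    have [measurable]: "Measurable.pred killed_path_space (\<lambda>w :: real \<Rightarrow> bool \<times> 'a. fst (w (real n)))"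
      "(\<lambda>w :: real \<Rightarrow> bool \<times> 'a. snd (w (real n))) \<in> killed_path_space \<rightarrow>\<^sub>M borel" for n
      by (rule killed_coordinates_measurable; simp)+
    show ?thesis by measurable
  qed
  finally show ?thesis .
qed


section \<open>The killed law and the resolvent\<close>
definition location_path :: "(real \<Rightarrow> bool \<times> 'a) \<Rightarrow> real \<Rightarrow> 'a" where
  "location_path w = (\<lambda>s\<in>{0..}. snd (w s))"

lemma location_path_measurable: "location_path \<in> killed_path_space \<rightarrow>\<^sub>M path_space"
  unfolding path_space_def
proof (intro measurable_restrict_space2 measurable_PiM_single')
  show "location_path \<in> space killed_path_space \<rightarrow> {w. cadlag w}"
    using cadlag_continuous_image[OF _ continuous_on_snd[OF continuous_on_id]]
    by (auto simp: space_killed_path_space location_path_def)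
  show "(\<lambda>w. location_path w s) \<in> killed_path_space \<rightarrow>\<^sub>M borel" if "s \<in> {0..}" for s
    using killed_coordinates_measurable(1)[of s] that by (simp add: location_path_def)
qed (auto simp: location_path_def PiE_def extensional_def)

lemma location_path_alive_path: "w \<in> space path_space \<Longrightarrow> location_path (alive_path w) = w"
  by (auto simp: location_path_def alive_path_def space_path_space extensional_def fun_eq_iff)

text \<open>
  Integer times suffice to recognise an unkilled path, because killing is irreversible. The
  event that a path is unkilled is thereby measurable.
\<close>

lemma alive_path_location_path:
  assumes w: "w \<in> space killed_path_space" and alive: "\<And>n::nat. \<not> fst (w (real n))"
  shows "alive_path (location_path w) = w"
proof -
  have "\<not> fst (w s)" if s: "0 \<le> s" for s
  proof
    assume "fst (w s)"
    then have "killing_time w \<le> ereal s" using killing_time_le_iff[OF w s] by simp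
    also obtain n :: nat where "s < real n" using reals_Archimedean2 by blast
    then have "ereal s \<le> ereal (real n)" by simp
    finally show False using killing_time_le_iff[OF w, of "real n"] alive by simp
  qed
  then show ?thesis
    using w by (auto simp: alive_path_def location_path_def space_killed_path_space extensional_def
        fun_eq_iff prod_eq_iff)
qed

text \<open>
  The rate is held constant before time 0 so that it is a function on the whole real line.
\<close>

definition rate_along :: "('a \<Rightarrow> real) \<Rightarrow> (real \<Rightarrow> 'a) \<Rightarrow> real \<Rightarrow> real" where
  "rate_along \<kappa> w t = \<kappa> (w (max 0 t))"

lemma survival_alive_path: "survival \<kappa> (alive_path w) t = survivor_function (rate_along \<kappa> w) t"
proof -
  have "(LBINT s:{0..t}. \<kappa> (snd (alive_path w s))) = (LBINT s:{0..t}. rate_along \<kappa> w s)"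
    by (rule set_lebesgue_integral_cong) (auto simp: alive_path_def rate_along_def)
  then show ?thesis by (simp add: survival_def survivor_function_def cumulative_hazard_def)
qed

locale killed_right_process = right_process P
  for P :: "'a::polish_space \<Rightarrow> (real \<Rightarrow> 'a) measure" +
  fixes \<kappa> :: "'a \<Rightarrow> real"
  assumes \<kappa>_borel [measurable]: "\<kappa> \<in> borel_measurable borel"
    and \<kappa>_nonneg: "0 \<le> \<kappa> y"
    and \<kappa>_locally_bounded: "locally_bounded \<kappa>"
begin

lemma rate_along_measurable:
  "(\<lambda>(w, t). rate_along \<kappa> w t) \<in> borel_measurable (path_space \<Otimes>\<^sub>M borel)"
  using measurable_compose[OF evaluation_measurable \<kappa>_borel]
  by (simp add: rate_along_def case_prod_beta)

lemma rate_along_compose_measurable [measurable (raw)]: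
  assumes "f \<in> M \<rightarrow>\<^sub>M path_space" "g \<in> borel_measurable M"
  shows "(\<lambda>x. rate_along \<kappa> (f x) (g x)) \<in> borel_measurable M"
  using measurable_compose[OF measurable_Pair[OF assms] rate_along_measurable] by simp

lemma hazard_rate_along:
  assumes w: "w \<in> space path_space" shows "hazard_rate (rate_along \<kappa> w)"
proof
  show "rate_along \<kappa> w \<in> borel_measurable borel"
    using measurable_compose[OF measurable_Pair1'[OF w] rate_along_measurable] by simp
  show "\<exists>C. \<forall>t\<in>{0..T}. rate_along \<kappa> w t \<le> C" for T
    using rate_along_path_bounded[of w \<kappa> T] w \<kappa>_locally_bounded
    by (auto simp: space_path_space rate_along_def)
qed (simp add: rate_along_def \<kappa>_nonneg)

lemma survivor_along_measurable [measurable]: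
  "(\<lambda>(w, t). survivor_function (rate_along \<kappa> w) t) \<in> borel_measurable (path_space \<Otimes>\<^sub>M borel)"
proof -
  have "(\<lambda>(x, s). indicator {0..snd x} s *\<^sub>R rate_along \<kappa> (fst x) s)
      \<in> borel_measurable ((path_space \<Otimes>\<^sub>M borel) \<Otimes>\<^sub>M lborel)"
    unfolding indicator_def atLeastAtMost_iff by measurable
  then have "(\<lambda>x. LINT s|lborel. indicator {0..snd x} s *\<^sub>R rate_along \<kappa> (fst x) s)
      \<in> borel_measurable (path_space \<Otimes>\<^sub>M borel)"
    by (rule lborel.borel_measurable_lebesgue_integral)
  then show ?thesis
    unfolding survivor_function_def cumulative_hazard_def set_lebesgue_integral_def case_prod_beta
    by measurable
qed

lemma lifetime_density_along_measurable [measurable]: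
  "(\<lambda>(w, t). lifetime_density (rate_along \<kappa> w) t) \<in> borel_measurable (path_space \<Otimes>\<^sub>M borel)"
  unfolding lifetime_density_def by measurable

text \<open>
  The mixture over paths and lifetimes that the killed law is meant to be: the path and the killing
  time are drawn from a joint density, and the path is then killed at this time.
\<close>

definition random_lifetime_law :: "'a \<Rightarrow> (real \<Rightarrow> bool \<times> 'a) measure" where
  "random_lifetime_law x =
     distr (density (P x \<Otimes>\<^sub>M lborel) (\<lambda>(w, t). lifetime_density (rate_along \<kappa> w) t))
       killed_path_space (\<lambda>(w, t). killed_path w (max 0 t))"

lemma sets_P [measurable_cong]: "sets (P x) = sets path_space"
  by (rule sets_law)

lemma space_P: "space (P x) = space path_space"
  by (rule sets_eq_imp_space_eq[OF sets_law])

lemma nn_integral_random_lifetime_law: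
  assumes f [measurable]: "f \<in> borel_measurable killed_path_space"
  shows "(\<integral>\<^sup>+w. f w \<partial>random_lifetime_law x)
    = (\<integral>\<^sup>+w. \<integral>\<^sup>+t. lifetime_density (rate_along \<kappa> w) t * f (killed_path w (max 0 t)) \<partial>lborel \<partial>P x)"
proof -
  note killed_path_measurable [measurable]
  have "(\<integral>\<^sup>+w. f w \<partial>random_lifetime_law x)
      = (\<integral>\<^sup>+(w, t). lifetime_density (rate_along \<kappa> w) t * f (killed_path w (max 0 t)) \<partial>(P x \<Otimes>\<^sub>M lborel))"
    unfolding random_lifetime_law_def
    by (subst nn_integral_distr, measurable)
       (subst nn_integral_density, measurable, simp add: case_prod_beta')
  also have "\<dots> = (\<integral>\<^sup>+w. \<integral>\<^sup>+t. lifetime_density (rate_along \<kappa> w) t * f (killed_path w (max 0 t)) \<partial>lborel \<partial>P x)"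
    by (subst lborel.nn_integral_fst[symmetric]) auto
  finally show ?thesis .
qed

lemma sets_random_lifetime_law [simp]: "sets (random_lifetime_law x) = sets killed_path_space"
  and space_random_lifetime_law [simp]: "space (random_lifetime_law x) = space killed_path_space"
  by (simp_all add: random_lifetime_law_def)

lemma nn_integral_kill_alive_path:
  assumes w: "w \<in> space path_space" and L [measurable]: "L \<in> sets killed_path_space"
  shows "(\<integral>\<^sup>+t\<in>{0..}. indicator L (kill t (alive_path w)) \<partial>interval_measure (\<lambda>t. - survival \<kappa> (alive_path w) t))
    = (\<integral>\<^sup>+t. lifetime_density (rate_along \<kappa> w) t * indicator L (killed_path w (max 0 t)) \<partial>lborel)"
proof -
  interpret hazard_rate "rate_along \<kappa> w" by (rule hazard_rate_along[OF w])
  have [measurable]: "(\<lambda>t. killed_path w (max 0 t)) \<in> borel \<rightarrow>\<^sub>M killed_path_space"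
    using measurable_compose[OF measurable_Pair1'[OF w] killed_path_measurable] by simp
  have "(\<integral>\<^sup>+t\<in>{0..}. indicator L (kill t (alive_path w)) \<partial>interval_measure (\<lambda>t. - survival \<kappa> (alive_path w) t))
    = (\<integral>\<^sup>+t. indicator {0..} t * indicator L (killed_path w (max 0 t)) \<partial>density lborel (lifetime_density (rate_along \<kappa> w)))"
    unfolding survival_alive_path interval_measure_survivor
    by (intro nn_integral_cong) (auto simp: indicator_def kill_alive_path)
  also have "\<dots> = (\<integral>\<^sup>+t. lifetime_density (rate_along \<kappa> w) t * (indicator {0..} t * indicator L (killed_path w (max 0 t))) \<partial>lborel)"
    by (subst nn_integral_density) auto
  also have "\<dots> = (\<integral>\<^sup>+t. lifetime_density (rate_along \<kappa> w) t * indicator L (killed_path w (max 0 t)) \<partial>lborel)"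
    by (intro nn_integral_cong) (auto simp: lifetime_density_def indicator_def)
  finally show ?thesis .
qed

lemma lifetime_integral_measurable:
  assumes [measurable]: "f \<in> borel_measurable killed_path_space"
  shows "(\<lambda>w. \<integral>\<^sup>+t. lifetime_density (rate_along \<kappa> w) t * f (killed_path w (max 0 t)) \<partial>lborel)
    \<in> borel_measurable path_space"
proof -
  note killed_path_measurable [measurable]
  show ?thesis by measurable
qed

text \<open>
  The killed law integrates a function of paths in \<open>{0,\<partial>} \<times> E\<close> against the image of \<open>P x\<close>
  under \<open>alive_path\<close>. That function is defined through a Lebesgue-Stieltjes measure depending on
  the path, and it is not clear that it is measurable on the whole killed path space. But almost every
  path for the image measure is unkilled, and on unkilled paths the function factors through the
  projection to \<open>E\<close>, where Fubini's theorem gives a measurable function. So the given values on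
  events are those of the measure \<open>random_lifetime_law\<close>.
\<close>

lemma killed_law_eq: "killed_law P \<kappa> x = random_lifetime_law x"
proof -
  let ?K = "killed_path_space :: (real \<Rightarrow> bool \<times> 'a) measure"
  let ?J = "\<lambda>L w. \<integral>\<^sup>+t\<in>{0..}. indicator L (kill t w) \<partial>interval_measure (\<lambda>t. - survival \<kappa> w t)"
  let ?H = "\<lambda>L w. \<integral>\<^sup>+t. lifetime_density (rate_along \<kappa> w) t * indicator L (killed_path w (max 0 t)) \<partial>lborel"
  have alive [measurable]: "alive_path \<in> P x \<rightarrow>\<^sub>M ?K"
    using alive_path_measurable by measurable
  have eq: "(\<integral>\<^sup>+w. ?J L w \<partial>unkilled_law P x) = emeasure (random_lifetime_law x) L"
    if L [measurable]: "L \<in> sets ?K" for L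
  proof -
    have H [measurable]: "?H L \<in> borel_measurable path_space"
      by (rule lifetime_integral_measurable) auto
    note location_path_measurable [measurable]
    have [measurable]: "Measurable.pred ?K (\<lambda>w. fst (w (real n)))" for n
      by (rule killed_coordinates_measurable) simp
    have "AE w in unkilled_law P x. \<forall>n::nat. \<not> fst (w (real n))"
      unfolding unkilled_law_def by (subst AE_distr_iff) (auto simp: alive_path_def)
    then have "AE w in unkilled_law P x. ?J L w = ?H L (location_path w)"
    proof (rule AE_mp, intro AE_I2 impI)
      fix w :: "real \<Rightarrow> bool \<times> 'a"
      assume "w \<in> space (unkilled_law P x)" and "\<forall>n::nat. \<not> fst (w (real n))"
      then have w: "alive_path (location_path w) = w" "location_path w \<in> space path_space"
        using alive_path_location_path[of w] measurable_space[OF location_path_measurable, of w]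
        by (auto simp: unkilled_law_def)
      show "?J L w = ?H L (location_path w)"
        using nn_integral_kill_alive_path[OF w(2) L] unfolding w(1) .
    qed
    then have "(\<integral>\<^sup>+w. ?J L w \<partial>unkilled_law P x) = (\<integral>\<^sup>+w. ?H L (location_path w) \<partial>unkilled_law P x)"
      by (rule nn_integral_cong_AE)
    also have "\<dots> = (\<integral>\<^sup>+w. ?H L (location_path (alive_path w)) \<partial>P x)"
      unfolding unkilled_law_def by (rule nn_integral_distr[OF alive]) measurable
    also have "\<dots> = (\<integral>\<^sup>+w. ?H L w \<partial>P x)"
      by (rule nn_integral_cong) (simp add: location_path_alive_path space_P)
    also have "\<dots> = (\<integral>\<^sup>+w. indicator L w \<partial>random_lifetime_law x)"
      by (rule nn_integral_random_lifetime_law[symmetric]) measurable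
    also have "\<dots> = emeasure (random_lifetime_law x) L" by simp
    finally show ?thesis .
  qed
  have "killed_law P \<kappa> x = measure_of (space ?K) (sets ?K) (emeasure (random_lifetime_law x))"
    unfolding killed_law_def
    by (rule measure_of_eq[OF sets.space_closed]) (simp add: eq sets.sigma_sets_eq)
  also have "\<dots> = random_lifetime_law x"
    using measure_of_of_measure[of "random_lifetime_law x"] by simp
  finally show ?thesis .
qed

lemma nn_integral_killed_law:
  assumes "f \<in> borel_measurable killed_path_space"
  shows "(\<integral>\<^sup>+w. f w \<partial>killed_law P \<kappa> x)
    = (\<integral>\<^sup>+w. \<integral>\<^sup>+t. lifetime_density (rate_along \<kappa> w) t * f (killed_path w (max 0 t)) \<partial>lborel \<partial>P x)"
  unfolding killed_law_eq by (rule nn_integral_random_lifetime_law[OF assms])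

lemma sets_killed_law: "sets (killed_law P \<kappa> x) = sets killed_path_space"
  by (simp add: killed_law_eq)

lemma emeasure_killed_at_location:
  assumes [measurable]: "A \<in> sets borel"
  shows "emeasure (killed_law P \<kappa> x)
      {w \<in> space killed_path_space. killing_time w < \<infinity> \<and> killing_location w \<in> A}
    = (\<integral>\<^sup>+w. \<integral>\<^sup>+t. lifetime_density (rate_along \<kappa> w) t * indicator A (w (max 0 t)) \<partial>lborel \<partial>P x)"
proof -
  let ?S = "{w \<in> space killed_path_space. killing_time w < \<infinity> \<and> killing_location w \<in> A}"
  note S [measurable] = killed_at_location_measurable[OF assms]
  have "emeasure (killed_law P \<kappa> x) ?S = (\<integral>\<^sup>+w. indicator ?S w \<partial>killed_law P \<kappa> x)"
    using S by (simp add: sets_killed_law)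
  also have "\<dots> = (\<integral>\<^sup>+w. \<integral>\<^sup>+t. lifetime_density (rate_along \<kappa> w) t * indicator ?S (killed_path w (max 0 t)) \<partial>lborel \<partial>P x)"
    by (rule nn_integral_killed_law) measurable
  also have "\<dots> = (\<integral>\<^sup>+w. \<integral>\<^sup>+t. lifetime_density (rate_along \<kappa> w) t * indicator A (w (max 0 t)) \<partial>lborel \<partial>P x)"
    by (intro nn_integral_cong)
       (auto simp: indicator_def space_P space_path_space killed_path_in_space simp del: ereal_max)
  finally show ?thesis .
qed

lemma emeasure_killed_law_space:
  "emeasure (killed_law P \<kappa> x) (space killed_path_space)
    = (\<integral>\<^sup>+w. \<integral>\<^sup>+t. lifetime_density (rate_along \<kappa> w) t \<partial>lborel \<partial>P x)"
proof -
  have "emeasure (killed_law P \<kappa> x) (space killed_path_space) = (\<integral>\<^sup>+w. 1 \<partial>killed_law P \<kappa> x)"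
    by (simp add: killed_law_eq)
  then show ?thesis using nn_integral_killed_law[of "\<lambda>_. 1" x] by simp
qed

lemma subprob_space_killed_law: "subprob_space (killed_law P \<kappa> x)"
proof (rule subprob_spaceI)
  interpret prob_space "P x" by (rule prob)
  have "(\<integral>\<^sup>+w. \<integral>\<^sup>+t. lifetime_density (rate_along \<kappa> w) t \<partial>lborel \<partial>P x) \<le> (\<integral>\<^sup>+w. 1 \<partial>P x)"
    by (intro nn_integral_mono hazard_rate.total_lifetime_density_le_1 hazard_rate_along) (simp add: space_P)
  then show "emeasure (killed_law P \<kappa> x) (space (killed_law P \<kappa> x)) \<le> 1"
    using emeasure_killed_law_space[of x] by (simp add: killed_law_eq emeasure_space_1)
  obtain w where "w \<in> space (P x)" using not_empty by blast
  then show "space (killed_law P \<kappa> x) \<noteq> {}"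
    using alive_path_in_space[of w] by (auto simp: killed_law_eq space_P space_path_space)
qed

text \<open>
  The values of the killed law on events are integrals against \<open>P x\<close> of a fixed function on
  path space, so they inherit universal measurability in \<open>x\<close>.
\<close>

lemma killed_law_kernel:
  assumes \<mu>: "initial_law \<mu>"
  shows "killed_law P \<kappa> \<in> completion \<mu> \<rightarrow>\<^sub>M subprob_algebra killed_path_space"
proof (rule measurable_subprob_algebra)
  have [measurable]: "P \<in> completion \<mu> \<rightarrow>\<^sub>M subprob_algebra path_space"
  proof (rule measurable_subprob_algebra)
    show "(\<lambda>x. emeasure (P x) L) \<in> borel_measurable (completion \<mu>)" if "L \<in> sets path_space" for L
      using kernel[OF that] \<mu> by (simp add: universally_measurable_def)
  qed (auto simp: sets_law prob prob_space_imp_subprob_space)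
  show "(\<lambda>x. emeasure (killed_law P \<kappa> x) L) \<in> borel_measurable (completion \<mu>)"
    if L [measurable]: "L \<in> sets killed_path_space" for L
  proof -
    let ?H = "\<lambda>w. \<integral>\<^sup>+t. lifetime_density (rate_along \<kappa> w) t * indicator L (killed_path w (max 0 t)) \<partial>lborel"
    have [measurable]: "?H \<in> borel_measurable path_space"
      by (rule lifetime_integral_measurable) measurable
    have "emeasure (killed_law P \<kappa> x) L = (\<integral>\<^sup>+w. ?H w \<partial>P x)" for x
      using nn_integral_killed_law[of "indicator L" x] L by (simp add: sets_killed_law)
    then show ?thesis by simp
  qed
qed (auto simp: sets_killed_law subprob_space_killed_law)

text \<open>
  The total mass of the lifetime density is at most one and has expectation one.
\<close>

lemma total_lifetime_mass_AE:
  assumes "emeasure (killed_law P \<kappa> x) {w \<in> space killed_path_space. killing_time w < \<infinity>} = 1"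
  shows "AE w in P x. (\<integral>\<^sup>+t. lifetime_density (rate_along \<kappa> w) t \<partial>lborel) = 1"
proof -
  interpret prob_space "P x" by (rule prob)
  let ?T = "\<lambda>w. \<integral>\<^sup>+t. lifetime_density (rate_along \<kappa> w) t \<partial>lborel"
  have le: "?T w \<le> 1" if "w \<in> space (P x)" for w
    using that by (intro hazard_rate.total_lifetime_density_le_1 hazard_rate_along) (simp add: space_P)
  have T: "(\<integral>\<^sup>+w. ?T w \<partial>P x) = 1"
    using emeasure_killed_at_location[of UNIV x] assms by simp
  have "(\<integral>\<^sup>+w. 1 - ?T w \<partial>P x) = (\<integral>\<^sup>+w. 1 \<partial>P x) - (\<integral>\<^sup>+w. ?T w \<partial>P x)"
    by (rule nn_integral_diff) (use le T in auto)
  also have "\<dots> = 0" using T by (simp add: emeasure_space_1)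
  finally have "AE w in P x. 1 - ?T w = 0"
    by (subst (asm) nn_integral_0_iff_AE) auto
  then show ?thesis
    by (rule AE_mp) (auto intro!: AE_I2 antisym le simp: diff_eq_0_iff_ennreal)
qed

text \<open>
  Being alive at time \<open>t\<close> means being killed at a time in \<open>{t<..}\<close>. Almost surely the lifetime has no
  mass at infinity, and this interval has mass \<open>m t\<close>.
\<close>

lemma killed_semigroup_eq:
  assumes f [measurable]: "f \<in> borel_measurable borel" and t: "0 \<le> t"
    and finite: "emeasure (killed_law P \<kappa> x) {w \<in> space killed_path_space. killing_time w < \<infinity>} = 1"
  shows "killed_semigroup P \<kappa> t x f
    = (\<integral>\<^sup>+w. f (w t) * ennreal (survivor_function (rate_along \<kappa> w) t) \<partial>P x)"
proof -
  have alive_iff: "indicator {w. ereal t < killing_time w} w = (indicator {w. \<not> fst (w t)} w :: ennreal)"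
    if "w \<in> space killed_path_space" for w :: "real \<Rightarrow> bool \<times> 'a"
    using killing_time_le_iff[OF that t] by (auto simp: indicator_def not_le)
  note [measurable] = killed_coordinates_measurable[OF t]
  have meas: "(\<lambda>w. f (snd (w t)) * indicator {w. \<not> fst (w t)} w) \<in> borel_measurable killed_path_space"
    unfolding indicator_def mem_Collect_eq by measurable
  have "killed_semigroup P \<kappa> t x f
      = (\<integral>\<^sup>+w. f (snd (w t)) * indicator {w. \<not> fst (w t)} w \<partial>killed_law P \<kappa> x)"
    unfolding killed_semigroup_def
    by (intro nn_integral_cong) (simp add: alive_iff killed_law_eq)
  also have "\<dots> = (\<integral>\<^sup>+w. \<integral>\<^sup>+s. lifetime_density (rate_along \<kappa> w) s *
      (f (snd (killed_path w (max 0 s) t)) * indicator {w. \<not> fst (w t)} (killed_path w (max 0 s))) \<partial>lborel \<partial>P x)"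
    by (rule nn_integral_killed_law[OF meas])
  also have "\<dots> = (\<integral>\<^sup>+w. \<integral>\<^sup>+s. f (w t) * (indicator {t<..} s * lifetime_density (rate_along \<kappa> w) s) \<partial>lborel \<partial>P x)"
    using t by (intro nn_integral_cong) (auto simp: indicator_def killed_path_apply mult.commute)
  also have "\<dots> = (\<integral>\<^sup>+w. f (w t) * ennreal (survivor_function (rate_along \<kappa> w) t) \<partial>P x)"
  proof (rule nn_integral_cong_AE)
    show "AE w in P x. (\<integral>\<^sup>+s. f (w t) * (indicator {t<..} s * lifetime_density (rate_along \<kappa> w) s) \<partial>lborel)
        = f (w t) * ennreal (survivor_function (rate_along \<kappa> w) t)"
      using total_lifetime_mass_AE[OF finite]
    proof (rule AE_mp, intro AE_I2 impI)
      fix w assume "w \<in> space (P x)" and total: "(\<integral>\<^sup>+t. lifetime_density (rate_along \<kappa> w) t \<partial>lborel) = 1"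
      then interpret hazard_rate "rate_along \<kappa> w" by (simp add: hazard_rate_along space_P)
      show "(\<integral>\<^sup>+s. f (w t) * (indicator {t<..} s * lifetime_density (rate_along \<kappa> w) s) \<partial>lborel)
        = f (w t) * ennreal (survivor_function (rate_along \<kappa> w) t)"
        by (simp add: nn_integral_cmult tail_of_lifetime_density[OF total t])
    qed
  qed
  finally show ?thesis .
qed

text \<open>
  Both sides integrate \<open>\<kappa> (w t) m t 1\<^sub>A (w t)\<close> over paths and times, in different orders.
\<close>

lemma killing_location_law:
  assumes A [measurable]: "A \<in> sets borel"
    and finite: "emeasure (killed_law P \<kappa> x) {w \<in> space killed_path_space. killing_time w < \<infinity>} = 1"
  shows "emeasure (killed_law P \<kappa> x)
      {w \<in> space killed_path_space. killing_time w < \<infinity> \<and> killing_location w \<in> A}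
    = resolvent P \<kappa> (\<lambda>y. ennreal (\<kappa> y) * indicator A y) x"
proof -
  interpret prob_space "P x" by (rule prob)
  interpret pair_sigma_finite "P x" lborel ..
  let ?g = "\<lambda>w t. lifetime_density (rate_along \<kappa> w) t * indicator A (w (max 0 t))"
  note evaluation_measurable [measurable]
  have g [measurable]: "(\<lambda>(w, t). ?g w t) \<in> borel_measurable (P x \<Otimes>\<^sub>M lborel)"
    by measurable
  have "resolvent P \<kappa> (\<lambda>y. ennreal (\<kappa> y) * indicator A y) x = (\<integral>\<^sup>+t. \<integral>\<^sup>+w. ?g w t \<partial>P x \<partial>lborel)"
    unfolding resolvent_def
  proof (rule nn_integral_cong)
    fix t :: real
    show "killed_semigroup P \<kappa> t x (\<lambda>y. ennreal (\<kappa> y) * indicator A y) * indicator {0..} t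
      = (\<integral>\<^sup>+w. ?g w t \<partial>P x)"
    proof (cases "0 \<le> t")
      case True
      have "killed_semigroup P \<kappa> t x (\<lambda>y. ennreal (\<kappa> y) * indicator A y)
          = (\<integral>\<^sup>+w. ennreal (\<kappa> (w t)) * indicator A (w t) * ennreal (survivor_function (rate_along \<kappa> w) t) \<partial>P x)"
        by (rule killed_semigroup_eq[OF _ True finite]) measurable
      also have "\<dots> = (\<integral>\<^sup>+w. ?g w t \<partial>P x)"
        using True by (intro nn_integral_cong)
          (simp add: lifetime_density_def rate_along_def ennreal_mult' \<kappa>_nonneg mult_ac)
      finally show ?thesis using True by simp
    qed (simp add: lifetime_density_def)
  qed
  also have "\<dots> = (\<integral>\<^sup>+w. \<integral>\<^sup>+t. ?g w t \<partial>lborel \<partial>P x)"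
    by (rule Fubini'[OF g])
  finally show ?thesis unfolding emeasure_killed_at_location[OF A] by (rule sym)
qed

end

theorem theorem3p1:
  fixes P :: "'a::polish_space \<Rightarrow> (real \<Rightarrow> 'a) measure"
    and \<kappa> :: "'a \<Rightarrow> real"
    and \<mu> :: "'a measure"
    and A :: "'a set"
  assumes "right_process P"
    and "\<kappa> \<in> borel_measurable borel"
    and "\<And>x. 0 \<le> \<kappa> x"
    and "locally_bounded \<kappa>"
    and "\<And>x. emeasure (killed_law P \<kappa> x) {w \<in> space killed_path_space. killing_time w < \<infinity>} = 1"
    and "prob_space \<mu>" and "sets \<mu> = sets borel"
    and "A \<in> sets borel"
  shows "emeasure (mixed_law \<mu> (killed_law P \<kappa>))
           {w \<in> space killed_path_space. killing_time w < \<infinity> \<and> killing_location w \<in> A}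
       = (\<integral>\<^sup>+x. resolvent P \<kappa> (\<lambda>y. ennreal (\<kappa> y) * indicator A y) x \<partial>completion \<mu>)"
proof -
  interpret right_process P by fact
  interpret killed_right_process P \<kappa> by standard (use assms in auto)
  have \<mu>: "initial_law \<mu>" using assms by (simp add: initial_law_def)
  let ?S = "{w \<in> space killed_path_space. killing_time w < \<infinity> \<and> killing_location w \<in> A}"
  have "emeasure (mixed_law \<mu> (killed_law P \<kappa>)) ?S
      = (\<integral>\<^sup>+x. emeasure (killed_law P \<kappa> x) ?S \<partial>completion \<mu>)"
    unfolding mixed_law_def
    using prob_space.not_empty[OF \<open>prob_space \<mu>\<close>]
    by (intro emeasure_bind[OF _ killed_law_kernel[OF \<mu>]] killed_at_location_measurable assms) simp
  then show ?thesis
    unfolding killing_location_law[OF \<open>A \<in> sets borel\<close> assms(5)] .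
qed

end
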